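(* Let $\mathcal{K}$ be a Krein space, $\mathcal{H}$ a Hilbert space, and let $\Gamma:\mathcal{K}^2\to\mathcal{H}^2$ be a Green's boundary relation. Let $M:=\operatorname{dom}\Gamma\cap(\operatorname{dom}\Gamma)^{[\perp]_{\mathcal{K}^2}}$ and $\tilde M:=\operatorname{ran}\Gamma\cap(\operatorname{ran}\Gamma)^{[\perp]_{\mathcal{H}^2}}$ be the isotropic manifolds of $\operatorname{dom}\Gamma$ and $\operatorname{ran}\Gamma$. Then: (i) $\tilde M=\operatorname{mul}\Gamma$ if and only if $M=\ker\Gamma$. (ii) If $\operatorname{dom}\Gamma\subseteq\mathcal{K}^2$ is closed and $\overline{\operatorname{ran}\Gamma}=\mathcal{H}^2$, then $\Gamma$ is a bounded operator. (iii) If either ($\overline{\operatorname{dom}\Gamma}=\mathcal{K}^2$ and $\operatorname{ran}\Gamma=\mathcal{H}^2$) or ($\overline{\operatorname{ran}\Gamma}=\mathcal{H}^2$ and $\operatorname{dom}\Gamma=\mathcal{K}^2$) holds, then $\Gamma$ is a standard unitary operator.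
   Context: Let $(\mathcal{K},[\cdot,\cdot])$ be a complex Krein space with the topology of an associated Hilbert space, and $(\mathcal{H},(\cdot,\cdot))$ a Hilbert space. Elements of $\mathcal{K}^2$ are written $\hat f=(f,f')$, $\hat g=(g,g')$, and elements of $\mathcal{H}^2$ are written $\hat h=(h,h')$, $\hat k=(k,k')$. Inner products are linear in the first argument. $\mathcal{K}^2$ and $\mathcal{H}^2$ are Krein spaces with the inner products $[\hat f,\hat g]_{\mathcal{K}^2}=-i[f',g]+i[f,g']$ and $[\hat h,\hat k]_{\mathcal{H}^2}=-i(h',k)+i(h,k')$; $[\perp]_{\mathcal{K}^2}$ and $[\perp]_{\mathcal{H}^2}$ denote orthogonal companions with respect to these. A linear relation $T:X\to Y$ is a linear subspace $T\subseteq X\times Y$, with the usual $\operatorname{dom}T$, $\operatorname{ran}T$, $\ker T=\{x:(x,0)\in T\}$, $\operatorname{mul}T=\{y:(0,y)\in T\}$; it is an operator if $\operatorname{mul}T=\{0\}$. A Green's boundary relation is a linear relation $\Gamma\subseteq\mathcal{K}^2\times\mathcal{H}^2$ such that $[f',g]-[f,g']=(h',k)-(h,k')$ for all $(\hat f,\hat h),(\hat g,\hat k)\in\Gamma$, equivalently $[\hat f,\hat g]_{\mathcal{K}^2}=[\hat h,\hat k]_{\mathcal{H}^2}$ for all such pairs (that is, $\Gamma$ is isometric between the Krein spaces $\mathcal{K}^2$ and $\mathcal{H}^2$). A standard unitary operator is an isometric operator $\Gamma$ with $\operatorname{dom}\Gamma=\mathcal{K}^2$ and $\operatorname{ran}\Gamma=\mathcal{H}^2$.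 *)

theory Defs
  imports "HOL-Analysis.Analysis"
begin

section \<open>Complex Hilbert spaces\<close>

class complex_vector = ab_group_add +
  fixes scaleC :: "complex \<Rightarrow> 'a \<Rightarrow> 'a"
  assumes scaleC_add_right: "scaleC a (x + y) = scaleC a x + scaleC a y"
    and scaleC_add_left: "scaleC (a + b) x = scaleC a x + scaleC b x"
    and scaleC_scaleC: "scaleC a (scaleC b x) = scaleC (a * b) x"
    and scaleC_one: "scaleC 1 x = x"

global_interpretation complex_vector: vector_space "scaleC :: complex \<Rightarrow> 'a \<Rightarrow> 'a::complex_vector"
  defines csubspace = complex_vector.subspace
  by unfold_locales (fact scaleC_add_right scaleC_add_left scaleC_scaleC scaleC_one)+

instantiation prod :: (complex_vector, complex_vector) complex_vector
begin
definition "scaleC a x = (scaleC a (fst x), scaleC a (snd x))"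
instance
  by standard
    (simp_all add: scaleC_prod_def scaleC_add_right scaleC_add_left scaleC_scaleC scaleC_one)
end

text \<open>The inner product is linear in its first argument.  Positive definiteness, the norm
  \<open>norm x = sqrt (Re (cinner x x))\<close> and the topology come from the underlying real inner product
  space, which is tied to the complex structure by the last two axioms.\<close>

class complex_inner = complex_vector + real_inner +
  fixes cinner :: "'a \<Rightarrow> 'a \<Rightarrow> complex"
  assumes cinner_add_left: "cinner (x + y) z = cinner x z + cinner y z"
    and cinner_scaleC_left: "cinner (scaleC a x) y = a * cinner x y"
    and cinner_commute: "cinner y x = cnj (cinner x y)"
    and scaleR_scaleC: "scaleR r x = scaleC (complex_of_real r) x"
    and inner_Re_cinner: "inner x y = Re (cinner x y)"

class chilbert_space = complex_inner + complete_space

instantiation complex :: chilbert_space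
begin
definition scaleC_complex :: "complex \<Rightarrow> complex \<Rightarrow> complex" where "scaleC_complex a x = a * x"
definition cinner_complex :: "complex \<Rightarrow> complex \<Rightarrow> complex" where "cinner_complex x y = x * cnj y"
instance
  by standard
    (simp_all add: scaleC_complex_def cinner_complex_def algebra_simps inner_complex_def
      scaleR_conv_of_real)
end


section \<open>Krein spaces\<close>

definition hermitian_form :: "('a::complex_vector \<Rightarrow> 'a \<Rightarrow> complex) \<Rightarrow> bool" where
  "hermitian_form B \<longleftrightarrow>
     (\<forall>x y z. B (x + y) z = B x z + B y z) \<and>
     (\<forall>a x y. B (scaleC a x) y = a * B x y) \<and>
     (\<forall>x y. B y x = cnj (B x y))"

text \<open>For a hermitian form \<open>B\<close>: the subspace \<open>S\<close> is a Hilbert space under \<open>B\<close>.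
  \<open>B x x\<close> is real, so the real part loses nothing; the absolute value is redundant on \<open>S\<close>, but
  \<open>Metric_space\<close> asks for a distance function that is nonnegative off \<open>S\<close> as well.\<close>

definition hilbert_on :: "'a::complex_vector set \<Rightarrow> ('a \<Rightarrow> 'a \<Rightarrow> complex) \<Rightarrow> bool" where
  "hilbert_on S B \<longleftrightarrow>
     csubspace S \<and> (\<forall>x\<in>S. x \<noteq> 0 \<longrightarrow> 0 < Re (B x x)) \<and>
     Metric_space.mcomplete S (\<lambda>x y. sqrt \<bar>Re (B (x - y) (x - y))\<bar>)"

definition fundamental_decomposition ::
    "('a::complex_vector \<Rightarrow> 'a \<Rightarrow> complex) \<Rightarrow> 'a set \<Rightarrow> 'a set \<Rightarrow> bool" where
  "fundamental_decomposition B P N \<longleftrightarrow>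
     hilbert_on P B \<and> hilbert_on N (\<lambda>x y. - B x y) \<and>
     (\<forall>x\<in>P. \<forall>y\<in>N. B x y = 0) \<and>
     P \<inter> N = {0} \<and> (\<forall>x. \<exists>p\<in>P. \<exists>n\<in>N. x = p + n)"

definition krein_space :: "('a::complex_vector \<Rightarrow> 'a \<Rightarrow> complex) \<Rightarrow> bool" where
  "krein_space B \<longleftrightarrow> hermitian_form B \<and> (\<exists>P N. fundamental_decomposition B P N)"

text \<open>\<open>ip\<close> is the Hilbert space inner product associated with some fundamental decomposition
  of the Krein space inner product \<open>B\<close>.\<close>

definition associated_inner ::
    "('a::complex_vector \<Rightarrow> 'a \<Rightarrow> complex) \<Rightarrow> ('a \<Rightarrow> 'a \<Rightarrow> complex) \<Rightarrow> bool" where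
  "associated_inner B ip \<longleftrightarrow>
     (\<exists>P N. fundamental_decomposition B P N \<and>
        (\<forall>p\<in>P. \<forall>n\<in>N. \<forall>q\<in>P. \<forall>m\<in>N. ip (p + n) (q + m) = B p q - B n m))"

definition square_form :: "('a \<Rightarrow> 'a \<Rightarrow> complex) \<Rightarrow> 'a \<times> 'a \<Rightarrow> 'a \<times> 'a \<Rightarrow> complex" where
  "square_form B = (\<lambda>(f, f') (g, g'). - \<i> * B f' g + \<i> * B f g')"

definition orth_companion :: "('a \<Rightarrow> 'a \<Rightarrow> complex) \<Rightarrow> 'a set \<Rightarrow> 'a set" where
  "orth_companion B L = {x. \<forall>y\<in>L. B x y = 0}"

definition isotropic_manifold :: "('a \<Rightarrow> 'a \<Rightarrow> complex) \<Rightarrow> 'a set \<Rightarrow> 'a set" where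
  "isotropic_manifold B L = L \<inter> orth_companion B L"


section \<open>Linear relations\<close>

text \<open>A linear relation is a subspace \<open>T\<close> of the product space (\<open>csubspace T\<close>); its domain and
  range are \<open>Domain T\<close> and \<open>Range T\<close>.\<close>

definition rel_ker :: "('a \<times> 'b::zero) set \<Rightarrow> 'a set" where
  "rel_ker T = {x. (x, 0) \<in> T}"

definition rel_mul :: "('a::zero \<times> 'b) set \<Rightarrow> 'b set" where
  "rel_mul T = {y. (0, y) \<in> T}"

definition is_operator :: "('a::complex_vector \<times> 'b::complex_vector) set \<Rightarrow> bool" where
  "is_operator T \<longleftrightarrow> csubspace T \<and> rel_mul T = {0}"

text \<open>A bounded operator need not be everywhere defined.\<close>

definition bounded_operator ::
    "('a::{complex_vector,real_normed_vector} \<times> 'b::{complex_vector,real_normed_vector}) set \<Rightarrow> bool"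
  where
  "bounded_operator T \<longleftrightarrow> is_operator T \<and> (\<exists>C. \<forall>(x, y)\<in>T. norm y \<le> C * norm x)"

definition isometric_relation ::
    "('a \<Rightarrow> 'a \<Rightarrow> complex) \<Rightarrow> ('b \<Rightarrow> 'b \<Rightarrow> complex) \<Rightarrow> ('a \<times> 'b) set \<Rightarrow> bool" where
  "isometric_relation B B' T \<longleftrightarrow> (\<forall>(f, h)\<in>T. \<forall>(g, k)\<in>T. B f g = B' h k)"

definition standard_unitary ::
    "('a::complex_vector \<Rightarrow> 'a \<Rightarrow> complex) \<Rightarrow> ('b::complex_vector \<Rightarrow> 'b \<Rightarrow> complex) \<Rightarrow>
     ('a \<times> 'b) set \<Rightarrow> bool" where
  "standard_unitary B B' T \<longleftrightarrow>
     is_operator T \<and> isometric_relation B B' T \<and> Domain T = UNIV \<and> Range T = UNIV"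

definition green_boundary_relation ::
    "('k::complex_vector \<Rightarrow> 'k \<Rightarrow> complex) \<Rightarrow> (('k \<times> 'k) \<times> ('h \<times> 'h::complex_inner)) set \<Rightarrow> bool"
  where
  "green_boundary_relation B \<Gamma> \<longleftrightarrow>
     csubspace \<Gamma> \<and>
     (\<forall>((f, f'), (h, h'))\<in>\<Gamma>. \<forall>((g, g'), (k, k'))\<in>\<Gamma>.
        B f' g - B f g' = cinner h' k - cinner h k')"

lemma green_boundary_relation_iff_isometric:
  "green_boundary_relation B \<Gamma> \<longleftrightarrow>
     csubspace \<Gamma> \<and> isometric_relation (square_form B) (square_form cinner) \<Gamma>"
proof -
  have "- \<i> * a + \<i> * b = - \<i> * c + \<i> * d \<longleftrightarrow> a - b = c - d" for a b c d :: complex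
  proof -
    have "- \<i> * a + \<i> * b = - \<i> * (a - b)" "- \<i> * c + \<i> * d = - \<i> * (c - d)"
      by (simp_all add: algebra_simps)
    then show ?thesis
      by (metis complex_i_not_zero mult_cancel_left neg_equal_0_iff_equal)
  qed
  then show ?thesis
    by (simp add: green_boundary_relation_def isometric_relation_def square_form_def
        split_beta del: mult_minus_left)
qed

end

theory Submission
  imports Defs
begin

text \<open>
  The boundary relation is an isometric relation between two spaces whose indefinite forms are
  continuous and have \<^emph>\<open>norming vectors\<close>: every \<open>x\<close> has a partner \<open>y\<close> with
  \<open>norm y \<le> norm x\<close> and \<open>B x y = (norm x)\<^sup>2\<close>, namely the image of \<open>x\<close> under a
  fundamental symmetry.  The norm of a vector can thus be recovered from the values of the form
  against a dense set; this is how the Krein space geometry enters.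

  For (i), isometry makes \<open>\<Gamma>\<close> match the isotropic vectors of its domain with those of its
  range: if \<open>(x, y) \<in> \<Gamma>\<close>, then \<open>x\<close> is isotropic iff \<open>y\<close> is
  (\<open>isotropic_manifold_transfer\<close>).  If the isotropic part of the range is only \<open>mul \<Gamma>\<close>, then
  \<open>(0, y) \<in> \<Gamma>\<close> can be subtracted, which leaves \<open>(x, 0)\<close>.

  For (ii), consider the functionals \<open>x \<mapsto> B x g\<close> on the closed, hence complete, domain,
  indexed by the pairs \<open>(g, k) \<in> \<Gamma>\<close> with \<open>norm k \<le> 1\<close>.  If \<open>(x, y) \<in> \<Gamma>\<close>, then
  \<open>B x g = B' y k\<close>, so the family is bounded at every point, hence uniformly bounded on a ball by
  the Banach-Steinhaus argument.  By scaling and density of the range, a bound for all these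
  \<open>B' y k\<close> is a bound for \<open>norm y\<close> (\<open>isometric_relation_bounded\<close>).  The estimate
  \<open>norm y \<le> C * norm x\<close> on \<open>\<Gamma>\<close> then forces \<open>mul \<Gamma>\<close> to be zero.

  For (iii), suppose that the domain is everything and the range is dense, so that \<open>\<Gamma>\<close> is bounded.
  Testing \<open>x\<close> against all \<open>g\<close> and using \<open>B x g = B' y k\<close> with \<open>norm k \<le> C * norm g\<close> shows
  that \<open>\<Gamma>\<close> is bounded below, so its range is closed
  (\<open>isometric_relation_range_closed\<close>) and therefore everything.  The other alternative is the
  same statement for the converse relation, which is again isometric.
\<close>

section \<open>Forms with norming vectors\<close>

text \<open>Bilinearity is over the reals, so that a form on a normed product space is covered in the
  same way as one on a complex inner product space.\<close>

locale norming_form = bounded_bilinear B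
  for B :: "'a::real_normed_vector \<Rightarrow> 'a \<Rightarrow> complex" +
  assumes norming: "\<exists>y. norm y \<le> norm x \<and> B x y = complex_of_real ((norm x)\<^sup>2)"

text \<open>Symmetry is used only in the form of single instances: as a rewrite rule it does not
  terminate.\<close>

lemma hermitian_form_simps:
  assumes "hermitian_form B"
  shows "B (x + y) z = B x z + B y z" "B x (y + z) = B x y + B x z"
    "B (scaleC a x) y = a * B x y" "B x (scaleC a y) = cnj a * B x y"
    "B (- x) y = - B x y" "B x (- y) = - B x y"
proof -
  note h = assms[unfolded hermitian_form_def]
  note add = h[THEN conjunct1, rule_format]
  note scale = h[THEN conjunct2, THEN conjunct1, rule_format]
  have sym: "B v u = cnj (B u v)" for u v
    by (rule h[THEN conjunct2, THEN conjunct2, rule_format])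
  show "B (x + y) z = B x z + B y z"
    by (rule add)
  show "B (scaleC a x) y = a * B x y"
    by (rule scale)
  show "B x (y + z) = B x y + B x z"
    unfolding sym[of x "y + z"] sym[of x y] sym[of x z] add by simp
  show "B x (scaleC a y) = cnj a * B x y"
    unfolding sym[of x "scaleC a y"] sym[of x y] scale by simp
  have neg: "B (- x) y = - B x y" for x y
    using add[of 0 0 y] add[of x "- x" y] by (simp add: add_eq_0_iff)
  show "B (- x) y = - B x y"
    by (rule neg)
  show "B x (- y) = - B x y"
    unfolding sym[of x "- y"] sym[of x y] neg by simp
qed

lemma hermitian_form_cinner: "hermitian_form (cinner :: 'a::complex_inner \<Rightarrow> 'a \<Rightarrow> complex)"
  unfolding hermitian_form_def
  using cinner_add_left cinner_scaleC_left cinner_commute by blast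

lemma cinner_self: "cinner x x = complex_of_real ((norm x)\<^sup>2)" for x :: "'a::complex_inner"
proof (rule complex_eqI)
  show "Re (cinner x x) = Re (complex_of_real ((norm x)\<^sup>2))"
    by (simp add: inner_Re_cinner[symmetric] power2_norm_eq_inner)
  have "Im (cinner x x) = - Im (cinner x x)"
    using arg_cong[OF cinner_commute[of x x], of Im] by simp
  then show "Im (cinner x x) = Im (complex_of_real ((norm x)\<^sup>2))"
    by simp
qed

lemma norm_scaleC: "norm (scaleC a x) = cmod a * norm x" for x :: "'a::complex_inner"
proof -
  have "complex_of_real ((norm (scaleC a x))\<^sup>2) = (a * cnj a) * complex_of_real ((norm x)\<^sup>2)"
    by (simp only: cinner_self[symmetric] hermitian_form_simps[OF hermitian_form_cinner] mult_ac)
  also have "\<dots> = complex_of_real ((cmod a * norm x)\<^sup>2)"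
    by (simp add: complex_norm_square[symmetric] power_mult_distrib)
  finally have "(norm (scaleC a x))\<^sup>2 = (cmod a * norm x)\<^sup>2"
    by (simp only: of_real_eq_iff)
  then show ?thesis
    by simp
qed

lemma norm_cinner_le: "cmod (cinner x y) \<le> norm x * norm y" for x y :: "'a::complex_inner"
proof (cases "cinner x y = 0")
  case False
  \<comment> \<open>Rotating \<open>x\<close> by the phase of \<open>cinner x y\<close> makes the complex inner product real.\<close>
  define a where "a = cnj (cinner x y) / cmod (cinner x y)"
  have a: "cmod a = 1"
    using False by (simp add: a_def norm_divide)
  have "a * cinner x y = cmod (cinner x y)"
    using False by (simp add: a_def mult.commute[of "cnj _"] complex_norm_square[symmetric] power2_eq_square)
  then have "cmod (cinner x y) = inner (scaleC a x) y"
    by (simp add: inner_Re_cinner cinner_scaleC_left)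
  also have "\<dots> \<le> norm (scaleC a x) * norm y"
    by (rule norm_cauchy_schwarz)
  finally show ?thesis
    by (simp add: norm_scaleC a)
qed simp

text \<open>The common source of norming vectors: if \<open>B x = cinner x'\<close> as functionals, then \<open>x'\<close> itself
  is norming for \<open>x\<close>, and the bound on \<open>B\<close> is the Cauchy-Schwarz inequality.\<close>

lemma norming_form_if_isometric_representation:
  fixes B :: "'a::complex_inner \<Rightarrow> 'a \<Rightarrow> complex"
  assumes herm: "hermitian_form B"
    and repr: "\<And>x. \<exists>x'. norm x' = norm x \<and> (\<forall>y. B x y = cinner x' y)"
  shows "norming_form B"
proof
  note simps = hermitian_form_simps[OF herm]
  show "B (x + y) z = B x z + B y z" "B x (y + z) = B x y + B x z" for x y z
    by (simp_all add: simps)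
  show "B (r *\<^sub>R x) y = r *\<^sub>R B x y" "B x (r *\<^sub>R y) = r *\<^sub>R B x y" for r x y
    by (simp_all only: scaleR_scaleC[where 'a = 'a] simps scaleR_conv_of_real complex_cnj_complex_of_real)
  show "\<exists>K. \<forall>x y. norm (B x y) \<le> norm x * norm y * K"
    by (rule exI[of _ 1]) (metis mult.right_neutral norm_cinner_le repr)
  show "\<exists>y. norm y \<le> norm x \<and> B x y = complex_of_real ((norm x)\<^sup>2)" for x
    by (metis cinner_self order_refl repr)
qed

lemma norming_form_cinner: "norming_form (cinner :: 'a::complex_inner \<Rightarrow> 'a \<Rightarrow> complex)"
  by (rule norming_form_if_isometric_representation[OF hermitian_form_cinner]) blast

text \<open>Here \<open>x'\<close> is the image of \<open>x\<close> under the fundamental symmetry \<open>p + n \<mapsto> p - n\<close> of the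
  decomposition that defines the associated inner product.\<close>

lemma norming_form_krein:
  fixes B :: "'a::complex_inner \<Rightarrow> 'a \<Rightarrow> complex"
  assumes herm: "hermitian_form B" and assoc: "associated_inner B cinner"
  shows "norming_form B"
proof (rule norming_form_if_isometric_representation[OF herm])
  note simps = hermitian_form_simps[OF herm]
  fix x :: 'a
  obtain P N where dec: "fundamental_decomposition B P N"
    and ip: "\<And>p n q m. p \<in> P \<Longrightarrow> n \<in> N \<Longrightarrow> q \<in> P \<Longrightarrow> m \<in> N \<Longrightarrow> cinner (p + n) (q + m) = B p q - B n m"
    using assoc unfolding associated_inner_def by blast
  have sub: "csubspace N" and span: "\<And>x. \<exists>p\<in>P. \<exists>n\<in>N. x = p + n"
    and orth: "\<And>p n. p \<in> P \<Longrightarrow> n \<in> N \<Longrightarrow> B p n = 0"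
    using dec unfolding fundamental_decomposition_def hilbert_on_def by blast+
  have orth': "B n p = 0" if "p \<in> P" "n \<in> N" for p n
    using herm orth[OF that] unfolding hermitian_form_def by (metis complex_cnj_zero)
  obtain p n where x: "x = p + n" and pn: "p \<in> P" "n \<in> N"
    using span by blast
  have n': "- n \<in> N"
    using sub pn(2) by (rule complex_vector.subspace_neg)
  have nn: "B (- n) (- n) = B n n"
    by (simp add: simps)
  \<comment> \<open>Both squared norms are \<open>B p p - B n n\<close>.  The image is written \<open>p + - n\<close> so that it is a sum of
    an element of \<open>P\<close> and an element of \<open>N\<close>.\<close>
  have "complex_of_real ((norm (p + - n))\<^sup>2) = complex_of_real ((norm x)\<^sup>2)"
    unfolding x cinner_self[symmetric] ip[OF pn pn] ip[OF pn(1) n' pn(1) n'] nn ..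
  then have "norm (p + - n) = norm x"
    by (simp only: of_real_eq_iff power2_eq_iff_nonneg norm_ge_zero)
  moreover have "B x y = cinner (p + - n) y" for y
  proof -
    obtain q m where y: "y = q + m" "q \<in> P" "m \<in> N"
      using span by blast
    show ?thesis
      using pn y unfolding x y(1) ip[OF pn(1) n' y(2,3)] by (simp add: simps orth orth')
  qed
  ultimately show "\<exists>x'. norm x' = norm x \<and> (\<forall>y. B x y = cinner x' y)"
    by blast
qed

text \<open>The form on the square pairs each component with the opposite one, so the norming vector
  of \<open>(f, f')\<close> consists of norming vectors of its components in exchanged places; the
  factors \<open>\<plusminus>\<i>\<close> cancel those in the form.\<close>

lemma norming_form_square_form:
  fixes B :: "'a::complex_inner \<Rightarrow> 'a \<Rightarrow> complex"
  assumes herm: "hermitian_form B" and "norming_form B"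
  shows "norming_form (square_form B)"
proof
  interpret B: norming_form B by fact
  note simps = hermitian_form_simps[OF herm]
  show "square_form B (x + y) z = square_form B x z + square_form B y z"
    "square_form B x (y + z) = square_form B x y + square_form B x z" for x y z
    by (simp_all add: square_form_def split_beta B.add_left B.add_right algebra_simps)
  show "square_form B (r *\<^sub>R x) y = r *\<^sub>R square_form B x y"
    "square_form B x (r *\<^sub>R y) = r *\<^sub>R square_form B x y" for r x y
    by (simp_all add: square_form_def split_beta B.scaleR_left B.scaleR_right algebra_simps)
  obtain K where K: "K \<ge> 0" "\<And>x y. norm (B x y) \<le> norm x * norm y * K"
    using B.nonneg_bounded by blast
  have "norm (square_form B x y) \<le> norm x * norm y * (2 * K)" for x y
  proof -
    have *: "norm (B u v) \<le> norm x * norm y * K" if "norm u \<le> norm x" "norm v \<le> norm y" for u v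
      using K that by (meson K mult_mono mult_right_mono norm_ge_zero order_trans)
    have "norm (square_form B x y) \<le> norm (B (snd x) (fst y)) + norm (B (fst x) (snd y))"
      unfolding square_form_def split_beta by (rule norm_triangle_le) (simp add: norm_mult)
    also have "\<dots> \<le> norm x * norm y * K + norm x * norm y * K"
      using norm_fst_le[of "fst x" "snd x"] norm_snd_le[of "snd x" "fst x"]
        norm_fst_le[of "fst y" "snd y"] norm_snd_le[of "snd y" "fst y"]
      by (intro add_mono *) simp_all
    finally show ?thesis
      by (simp add: mult_ac)
  qed
  then show "\<exists>K. \<forall>x y. norm (square_form B x y) \<le> norm x * norm y * K"
    by blast
  fix x :: "'a \<times> 'a"
  obtain u where u: "norm u \<le> norm (fst x)" "B (fst x) u = complex_of_real ((norm (fst x))\<^sup>2)"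
    using B.norming by blast
  obtain v where v: "norm v \<le> norm (snd x)" "B (snd x) v = complex_of_real ((norm (snd x))\<^sup>2)"
    using B.norming by blast
  let ?y = "(scaleC (- \<i>) v, scaleC \<i> u)"
  have "norm ?y \<le> norm x"
    unfolding norm_prod_def using u(1) v(1) by (simp add: norm_scaleC add.commute add_mono)
  moreover have "square_form B x ?y = complex_of_real ((norm x)\<^sup>2)"
    by (simp add: square_form_def split_beta simps u v norm_prod_def algebra_simps)
  ultimately show "\<exists>y. norm y \<le> norm x \<and> square_form B x y = complex_of_real ((norm x)\<^sup>2)"
    by blast
qed


section \<open>Isotropic vectors of isometric relations\<close>

lemma isometric_relationD:
  "isometric_relation B B' T \<Longrightarrow> (f, h) \<in> T \<Longrightarrow> (g, k) \<in> T \<Longrightarrow> B f g = B' h k"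
  unfolding isometric_relation_def by fast

lemma isometric_relation_converse:
  "isometric_relation B B' T \<Longrightarrow> isometric_relation B' B (T\<inverse>)"
  unfolding isometric_relation_def by fastforce

lemma rel_ker_converse: "rel_ker (T\<inverse>) = rel_mul T"
  by (auto simp: rel_ker_def rel_mul_def)

lemma rel_mul_converse: "rel_mul (T\<inverse>) = rel_ker T"
  by (auto simp: rel_ker_def rel_mul_def)

lemma subspace_relation_zero: "subspace T \<Longrightarrow> (0, 0) \<in> T"
  by (metis subspace_0 zero_prod_def)

lemma subspace_relation_scaleR: "subspace T \<Longrightarrow> (x, y) \<in> T \<Longrightarrow> (r *\<^sub>R x, r *\<^sub>R y) \<in> T"
  by (metis scaleR_Pair subspace_scale)

lemma subspace_relation_diff: "subspace T \<Longrightarrow> (x, y) \<in> T \<Longrightarrow> (u, v) \<in> T \<Longrightarrow> (x - u, y - v) \<in> T"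
  by (metis diff_Pair subspace_diff)

lemma subspace_relation_add: "subspace T \<Longrightarrow> (x, y) \<in> T \<Longrightarrow> (u, v) \<in> T \<Longrightarrow> (x + u, y + v) \<in> T"
  by (metis add_Pair subspace_add)

lemma subspace_converse: "subspace T \<Longrightarrow> subspace (T\<inverse>)"
  by (rule subspaceI)
    (auto simp: zero_prod_def subspace_relation_zero subspace_relation_add subspace_relation_scaleR)

text \<open>Orthogonality to the whole domain and to the whole range are both conditions on the
  pairs of \<open>T\<close>, and isometry identifies the two conditions.\<close>

lemma isotropic_manifold_transfer:
  assumes "isometric_relation B B' T" "(x, y) \<in> T"
  shows "x \<in> isotropic_manifold B (Domain T) \<longleftrightarrow> y \<in> isotropic_manifold B' (Range T)"
proof -
  have "(\<forall>g\<in>Domain T. B x g = 0) \<longleftrightarrow> (\<forall>(g, k)\<in>T. B x g = 0)"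
    by blast
  also have "\<dots> \<longleftrightarrow> (\<forall>(g, k)\<in>T. B' y k = 0)"
    using isometric_relationD[OF assms] by fastforce
  also have "\<dots> \<longleftrightarrow> (\<forall>k\<in>Range T. B' y k = 0)"
    by blast
  finally show ?thesis
    using assms(2) unfolding isotropic_manifold_def orth_companion_def by blast
qed

text \<open>One half of the equivalence; the other half is this lemma for \<open>T\<inverse>\<close>.\<close>

lemma isotropic_domain_eq_ker:
  assumes iso: "isometric_relation B B' T" and T: "subspace T"
    and mul: "isotropic_manifold B' (Range T) = rel_mul T"
  shows "isotropic_manifold B (Domain T) = rel_ker T"
proof (intro equalityI subsetI)
  fix x assume x: "x \<in> isotropic_manifold B (Domain T)"
  then obtain y where xy: "(x, y) \<in> T"
    unfolding isotropic_manifold_def by blast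
  then have "(0, y) \<in> T"
    using x mul isotropic_manifold_transfer[OF iso xy] unfolding rel_mul_def by blast
  then show "x \<in> rel_ker T"
    using subspace_relation_diff[OF T xy] unfolding rel_ker_def by fastforce
next
  fix x assume "x \<in> rel_ker T"
  then have x0: "(x, 0) \<in> T"
    unfolding rel_ker_def by blast
  \<comment> \<open>Through \<open>mul\<close>, isotropy of \<open>0\<close> is just \<open>(0, 0) \<in> T\<close>.\<close>
  have "0 \<in> isotropic_manifold B' (Range T)"
    unfolding mul rel_mul_def using subspace_relation_zero[OF T] by simp
  then show "x \<in> isotropic_manifold B (Domain T)"
    using isotropic_manifold_transfer[OF iso x0] by blast
qed

section \<open>Boundedness by a uniform boundedness argument\<close>

text \<open>By continuity the bound extends from \<open>D\<close> to the norming vector of \<open>x\<close>, where it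
  reads \<open>(norm x)\<^sup>2 \<le> C * norm x\<close>.\<close>

lemma (in norming_form) norm_le_if_bounded_on_dense:
  assumes dense: "closure D = UNIV" and "C \<ge> 0"
    and bound: "\<And>y. y \<in> D \<Longrightarrow> norm (B x y) \<le> C * norm y"
  shows "norm x \<le> C"
proof -
  have "closed {y. norm (B x y) \<le> C * norm y}"
    by (intro closed_Collect_le continuous_intros bounded_linear.continuous_on[OF bounded_linear_right])
  then have all: "norm (B x y) \<le> C * norm y" for y
    using closure_minimal[of D "{y. norm (B x y) \<le> C * norm y}"] bound dense by blast
  obtain y where "norm y \<le> norm x" "B x y = complex_of_real ((norm x)\<^sup>2)"
    using norming by blast
  then have "(norm x)\<^sup>2 \<le> C * norm x"
    using all[of y] \<open>C \<ge> 0\<close> by (metis abs_power2 mult_left_mono norm_of_real order_trans real_norm_def)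
  then show ?thesis
    using \<open>C \<ge> 0\<close> by (cases "x = 0") (simp_all add: power2_eq_square)
qed

text \<open>The category theorem for the closed set \<open>D\<close> as a complete metric space, stated with balls:
  some member of a countable closed cover has an interior point relative to \<open>D\<close>.\<close>

lemma Baire_closed_cover:
  fixes D :: "'a::{real_normed_vector,complete_space} set"
  assumes "closed D" "D \<noteq> {}" and clo: "\<And>n::nat. closed (A n)" and cover: "D \<subseteq> (\<Union>n. A n)"
  shows "\<exists>n x e. x \<in> D \<and> e > 0 \<and> D \<inter> ball x e \<subseteq> A n"
proof (rule ccontr)
  assume contra: "\<not> ?thesis"
  have "top_of_set D interior_of \<Union>(range (\<lambda>n. D \<inter> A n)) = {}"
  proof (rule Baire_category_alt)
    have "completely_metrizable_space (euclidean :: 'a topology)"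
      by (rule completely_metrizable_space_euclidean)
    then have "completely_metrizable_space (top_of_set D)"
      using \<open>closed D\<close> by (simp add: completely_metrizable_space_closedin)
    then show "completely_metrizable_space (top_of_set D) \<or>
        locally_compact_space (top_of_set D) \<and> regular_space (top_of_set D)" ..
    show "closedin (top_of_set D) G \<and> top_of_set D interior_of G = {}"
      if "G \<in> range (\<lambda>n. D \<inter> A n)" for G
    proof -
      obtain n where G: "G = D \<inter> A n"
        using \<open>G \<in> range _\<close> by blast
      have False if U: "x \<in> U" "openin (top_of_set D) U" "U \<subseteq> G" for x U
      proof -
        obtain e where "e > 0" "ball x e \<inter> D \<subseteq> U"
          using U(1,2) unfolding openin_contains_ball by blast
        then show False
          using contra U(3) openin_imp_subset[OF U(2)] U(1) unfolding G by blast
      qed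
      then have "top_of_set D interior_of G = {}"
        unfolding interior_of_def by blast
      then show ?thesis
        using clo by (simp add: G closedin_closed_Int)
    qed
  qed simp
  moreover have "\<Union>(range (\<lambda>n. D \<inter> A n)) = D"
    using cover by blast
  ultimately show False
    using \<open>D \<noteq> {}\<close> by (metis interior_of_topspace topspace_euclidean_subtopology)
qed

text \<open>A dense range would be too small for uniform boundedness of \<open>k \<mapsto> B' y k\<close> over the range,
  which need not be complete.  So the category argument runs over the domain, where the same
  numbers are values at \<open>x\<close> of the functionals \<open>x \<mapsto> B x g\<close>.\<close>

lemma isometric_relation_bounded:
  fixes T :: "('a::{real_normed_vector,complete_space} \<times> 'b::real_normed_vector) set"
  assumes "norming_form B" and "norming_form B'"
    and T: "subspace T" and iso: "isometric_relation B B' T"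
    and dom: "closed (Domain T)" and ran: "closure (Range T) = UNIV"
  shows "\<exists>C. \<forall>(x, y)\<in>T. norm y \<le> C * norm x"
proof -
  interpret B: norming_form B by fact
  interpret B': norming_form B' by fact
  define A where "A n = {x. \<forall>(g, k)\<in>T. norm k \<le> 1 \<longrightarrow> norm (B x g) \<le> real n}" for n
  have "\<exists>n x e. x \<in> Domain T \<and> e > 0 \<and> Domain T \<inter> ball x e \<subseteq> A n"
  proof (rule Baire_closed_cover[OF dom])
    show "Domain T \<noteq> {}"
      using subspace_relation_zero[OF T] by blast
    show "closed (A n)" for n
    proof -
      have "A n = (\<Inter>(g, k)\<in>{(g, k) \<in> T. norm k \<le> 1}. {x. norm (B x g) \<le> real n})"
        unfolding A_def by auto
      moreover have "closed {x. norm (B x g) \<le> real n}" for g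
        by (intro closed_Collect_le continuous_intros
            bounded_linear.continuous_on[OF B.bounded_linear_left])
      ultimately show ?thesis
        by (auto intro!: closed_INT)
    qed
    show "Domain T \<subseteq> (\<Union>n. A n)"
    proof
      fix x assume "x \<in> Domain T"
      then obtain y where xy: "(x, y) \<in> T" by blast
      obtain K where K: "K \<ge> 0" "\<And>u v. norm (B' u v) \<le> norm u * norm v * K"
        using B'.nonneg_bounded by blast
      obtain n where n: "norm y * K \<le> real n"
        using real_arch_simple by blast
      have "norm (B x g) \<le> real n" if "(g, k) \<in> T" "norm k \<le> 1" for g k
      proof -
        have "norm (B x g) \<le> norm y * norm k * K"
          using K(2) isometric_relationD[OF iso xy that(1)] by simp
        also have "\<dots> \<le> norm y * 1 * K"
          using K(1) that(2) by (intro mult_mono) auto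
        finally show ?thesis using n by simp
      qed
      then show "x \<in> (\<Union>n. A n)"
        unfolding A_def by blast
    qed
  qed
  then obtain n x0 e where x0: "x0 \<in> Domain T" and e: "e > 0" and ball: "Domain T \<inter> ball x0 e \<subseteq> A n"
    by blast
  \<comment> \<open>Writing \<open>x = (x0 + x) - x0\<close> moves the bound from the ball around \<open>x0\<close> to one around \<open>0\<close>, at
    the cost of a factor \<open>2\<close>.\<close>
  have small: "norm y \<le> 2 * real n" if xy: "(x, y) \<in> T" and "norm x < e" for x y
  proof (rule B'.norm_le_if_bounded_on_dense[OF ran])
    obtain y0 where y0: "(x0, y0) \<in> T"
      using x0 by blast
    have x0A: "x0 \<in> A n"
      using ball x0 e by auto
    have "x0 + x \<in> Domain T"
      using subspace_relation_add[OF T y0 xy] by blast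
    then have xA: "x0 + x \<in> A n"
      using ball \<open>norm x < e\<close> by (auto simp: dist_norm)
    fix k assume "k \<in> Range T"
    then obtain g where gk: "(g, k) \<in> T" by blast
    have unit: "norm (B' y k) \<le> 2 * real n" if gk: "(g, k) \<in> T" "norm k \<le> 1" for g k
    proof -
      have "norm (B' y k) = norm (B (x0 + x) g - B x0 g)"
        using isometric_relationD[OF iso xy gk(1)] by (simp add: B.add_left)
      also have "\<dots> \<le> norm (B (x0 + x) g) + norm (B x0 g)"
        by (rule norm_triangle_ineq4)
      also have "\<dots> \<le> real n + real n"
        using xA x0A gk unfolding A_def by (intro add_mono) blast+
      finally show ?thesis by simp
    qed
    show "norm (B' y k) \<le> 2 * real n * norm k"
    proof (cases "k = 0")
      case False
      have "norm (B' y (inverse (norm k) *\<^sub>R k)) \<le> 2 * real n"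
        using False by (intro unit[OF subspace_relation_scaleR[OF T gk]]) simp
      then show ?thesis
        using False by (simp add: B'.scaleR_right field_simps)
    qed (simp add: B'.zero_right)
  qed simp
  have "norm y \<le> (4 * real n / e) * norm x" if xy: "(x, y) \<in> T" for x y
  proof (cases "x = 0")
    case True
    \<comment> \<open>All multiples of \<open>y\<close> are images of \<open>0\<close>, hence they are bounded in norm.\<close>
    have bd: "r * norm y \<le> 2 * real n" if "r > 0" for r
      using small[OF subspace_relation_scaleR[OF T xy, of r]] that e True by simp
    have "y = 0"
    proof (rule ccontr)
      assume "y \<noteq> 0"
      then show False
        using bd[of "(2 * real n + 1) / norm y"] by (simp add: add_pos_nonneg)
    qed
    then show ?thesis by (simp add: True)
  next
    case False
    \<comment> \<open>The factor makes the norm of the scaled \<open>x\<close> equal to \<open>e / 2\<close>.\<close>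
    have "norm ((e / (2 * norm x)) *\<^sub>R y) \<le> 2 * real n"
      using False e by (intro small[OF subspace_relation_scaleR[OF T xy]]) simp
    then show ?thesis
      using False e by (simp add: field_simps)
  qed
  then show ?thesis
    by blast
qed

section \<open>Everywhere defined isometric relations\<close>

text \<open>Boundedness together with isometry forces \<open>norm x \<le> L * norm y\<close> for \<open>(x, y) \<in> T\<close>, since
  \<open>x\<close> is determined in norm by the values \<open>B x g = B' y k\<close> and \<open>norm k \<le> C * norm g\<close>.  Hence
  preimages of a convergent sequence are Cauchy, and their limit is in the domain.\<close>

lemma isometric_relation_range_closed:
  fixes T :: "('a::{real_normed_vector,complete_space} \<times> 'b::real_normed_vector) set"
  assumes "norming_form B" and "norming_form B'"
    and T: "subspace T" and iso: "isometric_relation B B' T"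
    and dom: "Domain T = UNIV" and bound: "\<forall>(x, y)\<in>T. norm y \<le> C * norm x"
  shows "closed (Range T)"
proof -
  interpret B: norming_form B by fact
  interpret B': norming_form B' by fact
  obtain K where K: "K \<ge> 0" "\<And>u v. norm (B' u v) \<le> norm u * norm v * K"
    using B'.nonneg_bounded by blast
  \<comment> \<open>The constant is kept positive because it will be divided by; \<open>C\<close> itself may be negative.\<close>
  define L where "L = max 1 (K * C)"
  have below: "norm x \<le> L * norm y" if xy: "(x, y) \<in> T" for x y
  proof (rule B.norm_le_if_bounded_on_dense[of UNIV])
    fix g :: 'a
    obtain k where gk: "(g, k) \<in> T"
      using dom by blast
    have "norm (B x g) \<le> norm y * norm k * K"
      using K(2) isometric_relationD[OF iso xy gk] by simp
    also have "\<dots> \<le> norm y * (C * norm g) * K"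
      using bound gk K(1) by (intro mult_right_mono mult_left_mono) auto
    also have "\<dots> = (K * C) * (norm y * norm g)"
      by simp
    also have "\<dots> \<le> L * (norm y * norm g)"
      unfolding L_def by (intro mult_right_mono) auto
    finally show "norm (B x g) \<le> L * norm y * norm g"
      by (simp add: mult.assoc)
  qed (auto simp: L_def)
  show ?thesis
    unfolding closed_sequential_limits
  proof (intro allI impI, elim conjE)
    fix y l assume "\<forall>n::nat. y n \<in> Range T" and lim: "y \<longlonglongrightarrow> l"
    then have "\<forall>n. \<exists>u. (u, y n) \<in> T"
      by blast
    then obtain x where xy: "\<And>n. (x n, y n) \<in> T"
      by metis
    have "L > 0"
      unfolding L_def by simp
    have dist: "dist (x m) (x n) \<le> L * dist (y m) (y n)" for m n
      using below[OF subspace_relation_diff[OF T xy xy]] by (simp add: dist_norm)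
    have "Cauchy x"
    proof (rule metric_CauchyI)
      fix e :: real assume "e > 0"
      then obtain M where "\<And>m n. m \<ge> M \<Longrightarrow> n \<ge> M \<Longrightarrow> dist (y m) (y n) < e / L"
        using LIMSEQ_imp_Cauchy[OF lim] \<open>L > 0\<close> metric_CauchyD[of y "e / L"] by (metis divide_pos_pos)
      then show "\<exists>M. \<forall>m\<ge>M. \<forall>n\<ge>M. dist (x m) (x n) < e"
        using dist \<open>L > 0\<close>
        by (metis (no_types, lifting) less_divide_eq mult.commute order_le_less_trans)
    qed
    then obtain a where a: "x \<longlonglongrightarrow> a"
      using Cauchy_convergent convergent_def by blast
    obtain b where ab: "(a, b) \<in> T"
      using dom by blast
    have le: "norm (y n - b) \<le> C * norm (x n - a)" for n
      using bound subspace_relation_diff[OF T xy[of n] ab] by blast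
    have "(\<lambda>n. norm (x n - a)) \<longlonglongrightarrow> 0"
      using a LIM_zero tendsto_norm_zero by blast
    then have "(\<lambda>n. C * norm (x n - a)) \<longlonglongrightarrow> 0"
      by (rule tendsto_mult_right_zero)
    then have "(\<lambda>n. y n - b) \<longlonglongrightarrow> 0"
      by (rule Lim_null_comparison[rotated]) (simp add: le)
    then have "y \<longlonglongrightarrow> b"
      using LIM_zero_cancel by blast
    then show "l \<in> Range T"
      using lim LIMSEQ_unique ab by blast
  qed
qed

lemma rel_mul_zero_if_bounded:
  assumes "subspace T" "\<forall>(x, y)\<in>T. norm y \<le> C * norm x"
  shows "rel_mul T = {0}"
  using assms subspace_relation_zero[OF assms(1)] unfolding rel_mul_def by fastforce

lemma isometric_relation_everywhere_defined:
  fixes T :: "('a::{real_normed_vector,complete_space} \<times> 'b::real_normed_vector) set"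
  assumes forms: "norming_form B" "norming_form B'"
    and T: "subspace T" and iso: "isometric_relation B B' T"
    and dom: "Domain T = UNIV" and ran: "closure (Range T) = UNIV"
  shows "rel_mul T = {0}" "Range T = UNIV"
proof -
  obtain C where C: "\<forall>(x, y)\<in>T. norm y \<le> C * norm x"
    using isometric_relation_bounded[OF forms T iso _ ran] dom by auto
  show "rel_mul T = {0}"
    by (rule rel_mul_zero_if_bounded[OF T C])
  show "Range T = UNIV"
    using isometric_relation_range_closed[OF forms T iso dom C] ran by simp
qed

section \<open>Green's boundary relations\<close>

text \<open>The product spaces carry their real and complex scalar multiplications independently;
  they agree because they agree in each component.\<close>

lemma csubspace_imp_subspace:
  fixes T :: "(('k::complex_inner \<times> 'k) \<times> ('h::complex_inner \<times> 'h)) set"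
  assumes "csubspace T"
  shows "subspace T"
proof -
  have "r *\<^sub>R x = scaleC (complex_of_real r) x" for r and x :: "('k \<times> 'k) \<times> ('h \<times> 'h)"
    by (simp add: scaleR_prod_def scaleC_prod_def scaleR_scaleC)
  then show ?thesis
    using assms unfolding subspace_def
    by (simp add: complex_vector.subspace_0 complex_vector.subspace_add complex_vector.subspace_scale)
qed

theorem proposition5p1:
  fixes kip :: "'k::chilbert_space \<Rightarrow> 'k \<Rightarrow> complex"
    and \<Gamma> :: "(('k \<times> 'k) \<times> ('h::chilbert_space \<times> 'h)) set"
  assumes "krein_space kip"
    and "associated_inner kip (cinner :: 'k \<Rightarrow> 'k \<Rightarrow> complex)"
    and "green_boundary_relation kip \<Gamma>"
  shows "(isotropic_manifold (square_form cinner) (Range \<Gamma>) = rel_mul \<Gamma> \<longleftrightarrow>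
            isotropic_manifold (square_form kip) (Domain \<Gamma>) = rel_ker \<Gamma>) \<and>
         (closed (Domain \<Gamma>) \<and> closure (Range \<Gamma>) = UNIV \<longrightarrow> bounded_operator \<Gamma>) \<and>
         ((closure (Domain \<Gamma>) = UNIV \<and> Range \<Gamma> = UNIV) \<or>
          (closure (Range \<Gamma>) = UNIV \<and> Domain \<Gamma> = UNIV) \<longrightarrow>
            standard_unitary (square_form kip) (square_form cinner) \<Gamma>)"
proof -
  let ?B = "square_form kip" and ?B' = "square_form (cinner :: 'h \<Rightarrow> 'h \<Rightarrow> complex)"
  have herm: "hermitian_form kip"
    using assms(1) unfolding krein_space_def by blast
  have B: "norming_form ?B"
    by (rule norming_form_square_form[OF herm norming_form_krein[OF herm assms(2)]])
  have B': "norming_form ?B'"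
    by (rule norming_form_square_form[OF hermitian_form_cinner norming_form_cinner])
  have csub: "csubspace \<Gamma>" and iso: "isometric_relation ?B ?B' \<Gamma>"
    using assms(3) unfolding green_boundary_relation_iff_isometric by blast+
  have sub: "subspace \<Gamma>"
    by (rule csubspace_imp_subspace[OF csub])
  note sub' = subspace_converse[OF sub] and iso' = isometric_relation_converse[OF iso]
  have i: "isotropic_manifold ?B' (Range \<Gamma>) = rel_mul \<Gamma> \<longleftrightarrow> isotropic_manifold ?B (Domain \<Gamma>) = rel_ker \<Gamma>"
    using isotropic_domain_eq_ker[OF iso sub] isotropic_domain_eq_ker[OF iso' sub']
    by (auto simp: rel_ker_converse rel_mul_converse)
  have ii: "bounded_operator \<Gamma>" if dom: "closed (Domain \<Gamma>)" and ran: "closure (Range \<Gamma>) = UNIV"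
  proof -
    obtain C where C: "\<forall>(x, y)\<in>\<Gamma>. norm y \<le> C * norm x"
      using isometric_relation_bounded[OF B B' sub iso dom ran] by blast
    then show ?thesis
      unfolding bounded_operator_def is_operator_def
      using csub rel_mul_zero_if_bounded[OF sub C] by blast
  qed
  have iii1: "standard_unitary ?B ?B' \<Gamma>" if "closure (Range \<Gamma>) = UNIV" "Domain \<Gamma> = UNIV"
    unfolding standard_unitary_def is_operator_def
    using isometric_relation_everywhere_defined[OF B B' sub iso that(2,1)] csub iso that by blast
  \<comment> \<open>The converse relation supplies only \<open>Domain \<Gamma> = UNIV\<close>; after that the range is trivially
    dense and the first alternative applies.\<close>
  have iii2: "standard_unitary ?B ?B' \<Gamma>" if "closure (Domain \<Gamma>) = UNIV" "Range \<Gamma> = UNIV"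
  proof -
    have "Domain \<Gamma> = UNIV"
      using isometric_relation_everywhere_defined(2)[OF B' B sub' iso'] that by simp
    then show ?thesis
      using iii1 that(2) by simp
  qed
  show ?thesis
    using i ii iii1 iii2 by blast
qed

end
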